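(* For every partition $\lambda$ and every positive integer $n$, the polynomial $G_\lambda(\mathbf{x}_n;\mathbf{1};\mathbf{1})$ (the hybrid Grothendieck polynomial of straight shape $\lambda$ with all $t_i=w_i=1$ and $x_k=0$ for $k>n$) has saturated Newton polytope. Equivalently, regarding $G_\lambda(\mathbf{x}_n;\mathbf{t};\mathbf{w})$ as a polynomial in $x_1,\ldots,x_n$ with coefficients depending on generic parameters $\mathbf{t},\mathbf{w}$, it has saturated Newton polytope.
   Context: Boxes are $(i,j)$ (row $i$, column $j$). An SVRPP of shape $\lambda$ (a partition) is a filling $T$ assigning a nonempty finite set $T(i,j)$ of positive integers to each box of the Young diagram of $\lambda$ such that sets weakly increase along rows and down columns, where $A\le B$ means $\max A\le\min B$. $\mathrm{SVRPP}^n(\lambda)$: those with all sets contained in $\{1,\ldots,n\}$. $\mathrm{ircont}(T)=(r_1,r_2,\ldots)$ with $r_k$ the number of columns containing a box whose set contains $k$; $\mathrm{ceq}(T)=(c_1,\ldots)$ with $c_i$ the number of boxes $(i,j)$ with $(i+1,j)$ in the diagram and $\max T(i,j)=\min T(i+1,j)$; $\mathrm{ex}(T)=(e_1,\ldots)$ with $e_i=\sum_j(|T(i,j)|-1)$ over boxes of row $i$. $G_\lambda(\mathbf{x}_n;\mathbf{t};\mathbf{w})=\sum_{T\in\mathrm{SVRPP}^n(\lambda)}\mathbf{x}^{\mathrm{ircont}(T)}\mathbf{t}^{\mathrm{ceq}(T)}\mathbf{w}^{\mathrm{ex}(T)}$ where $\mathbf{y}^\alpha=\prod_k y_k^{\alpha_k}$.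 The Newton polytope of a polynomial $f=\sum_{\gamma\in\mathbb{Z}_{\ge0}^n}c_\gamma\mathbf{x}_n^\gamma$ is the convex hull of $\{\gamma: c_\gamma\ne0\}$; $f$ has saturated Newton polytope (SNP) if every lattice point of its Newton polytope is some $\gamma$ with $c_\gamma\neq0$. *)

theory Defs
  imports "HOL-Analysis.Analysis" "HOL-Analysis.Finite_Function_Topology"
begin

section \<open>Set-valued reverse plane partitions\<close>

definition is_partition :: "nat list \<Rightarrow> bool" where
  "is_partition lam \<longleftrightarrow> sorted_wrt (\<ge>) lam \<and> 0 \<notin> set lam"

text \<open>Boxes \<open>(i, j)\<close> (row, column) are indexed from 1.\<close>

definition diagram :: "nat list \<Rightarrow> (nat \<times> nat) set" where
  "diagram lam = {(i, j). 1 \<le> i \<and> i \<le> length lam \<and> 1 \<le> j \<and> j \<le> lam ! (i - 1)}"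

definition set_le :: "nat set \<Rightarrow> nat set \<Rightarrow> bool" where
  "set_le A B \<longleftrightarrow> Max A \<le> Min B"

text \<open>Fillings are total functions, so they are required to be empty off the diagram; this makes
  each filling of the diagram correspond to exactly one function.\<close>

definition SVRPP :: "nat list \<Rightarrow> (nat \<times> nat \<Rightarrow> nat set) set" where
  "SVRPP lam = {T.
     (\<forall>b \<in> diagram lam. finite (T b) \<and> T b \<noteq> {} \<and> 0 \<notin> T b) \<and>
     (\<forall>b. b \<notin> diagram lam \<longrightarrow> T b = {}) \<and>
     (\<forall>i j. (i, j) \<in> diagram lam \<and> (i, j + 1) \<in> diagram lam \<longrightarrow> set_le (T (i, j)) (T (i, j + 1))) \<and>
     (\<forall>i j. (i, j) \<in> diagram lam \<and> (i + 1, j) \<in> diagram lam \<longrightarrow> set_le (T (i, j)) (T (i + 1, j)))}"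

definition SVRPP_upto :: "nat \<Rightarrow> nat list \<Rightarrow> (nat \<times> nat \<Rightarrow> nat set) set" where
  "SVRPP_upto n lam = {T \<in> SVRPP lam. \<forall>b \<in> diagram lam. T b \<subseteq> {1..n}}"

definition ircont :: "nat list \<Rightarrow> (nat \<times> nat \<Rightarrow> nat set) \<Rightarrow> nat \<Rightarrow> nat" where
  "ircont lam T k = card {j. \<exists>i. (i, j) \<in> diagram lam \<and> k \<in> T (i, j)}"

definition ceq :: "nat list \<Rightarrow> (nat \<times> nat \<Rightarrow> nat set) \<Rightarrow> nat \<Rightarrow> nat" where
  "ceq lam T i = card {j. (i, j) \<in> diagram lam \<and> (i + 1, j) \<in> diagram lam \<and>
                          Max (T (i, j)) = Min (T (i + 1, j))}"

definition ex :: "nat list \<Rightarrow> (nat \<times> nat \<Rightarrow> nat set) \<Rightarrow> nat \<Rightarrow> nat" where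
  "ex lam T i = (\<Sum>j | (i, j) \<in> diagram lam. card (T (i, j)) - 1)"

lemma finite_diagram: "finite (diagram lam)"
proof (rule finite_subset)
  show "diagram lam \<subseteq> (SIGMA i:{1..length lam}. {1..lam ! (i - 1)})"
    by (auto simp: diagram_def)
qed auto

lemma finite_SVRPP_upto: "finite (SVRPP_upto n lam)"
proof (rule finite_subset)
  show "SVRPP_upto n lam \<subseteq>
    {T. \<forall>b. (b \<in> diagram lam \<longrightarrow> T b \<in> Pow {1..n}) \<and> (b \<notin> diagram lam \<longrightarrow> T b = {})}"
    by (auto simp: SVRPP_upto_def SVRPP_def)
  show "finite {T. \<forall>b. (b \<in> diagram lam \<longrightarrow> T b \<in> Pow {1..n}) \<and> (b \<notin> diagram lam \<longrightarrow> T b = {})}"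
    by (rule finite_set_of_finite_funs) (auto simp: finite_diagram)
qed


section \<open>Hybrid Grothendieck polynomials\<close>

text \<open>For finitely supported \<open>\<alpha>\<close> this is the monomial \<open>\<Prod>k. y k ^ \<alpha> k\<close>.\<close>

definition mono_pow :: "(nat \<Rightarrow> 'a::comm_semiring_1) \<Rightarrow> (nat \<Rightarrow> nat) \<Rightarrow> 'a" where
  "mono_pow y \<alpha> = (\<Prod>k | \<alpha> k \<noteq> 0. y k ^ \<alpha> k)"

definition hybrid_G ::
    "nat list \<Rightarrow> nat \<Rightarrow> (nat \<Rightarrow> 'a::comm_semiring_1) \<Rightarrow> (nat \<Rightarrow> 'a) \<Rightarrow> (nat \<Rightarrow> 'a) \<Rightarrow> 'a" where
  "hybrid_G lam n x t w =
     (\<Sum>T \<in> SVRPP_upto n lam.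
        mono_pow x (ircont lam T) * mono_pow t (ceq lam T) * mono_pow w (ex lam T))"


section \<open>Polynomials and saturated Newton polytopes\<close>

text \<open>A polynomial over \<open>'a\<close> in the variables \<open>'v\<close> is a finitely supported function from exponent
  vectors \<open>'v \<Rightarrow>\<^sub>0 nat\<close> to coefficients, with the convolution product.\<close>

type_synonym ('v, 'a) mpol = "('v \<Rightarrow>\<^sub>0 nat) \<Rightarrow>\<^sub>0 'a"

definition pvar :: "'v \<Rightarrow> ('v, 'a::comm_semiring_1) mpol" where
  "pvar v = Poly_Mapping.single (Poly_Mapping.single v 1) 1"

definition pconst :: "'a::comm_semiring_1 \<Rightarrow> ('v, 'a) mpol" where
  "pconst c = Poly_Mapping.single 0 c"

definition real_exponent :: "('v \<Rightarrow>\<^sub>0 nat) \<Rightarrow> ('v \<Rightarrow>\<^sub>0 real)" where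
  "real_exponent \<gamma> = Poly_Mapping.map real \<gamma>"

text \<open>The polytope lives in the space \<open>'v \<Rightarrow>\<^sub>0 real\<close> of finitely supported real vectors. If \<open>f\<close>
  involves only the variables in a set \<open>V\<close>, it lies in the coordinate subspace of \<open>V\<close>, so for
  \<open>V = {1..n}\<close> this is the usual polytope in \<open>n\<close>-dimensional space and has the same
  lattice points.\<close>

definition newton_polytope :: "('v, 'a::zero) mpol \<Rightarrow> ('v \<Rightarrow>\<^sub>0 real) set" where
  "newton_polytope f = convex hull (real_exponent ` {\<gamma>. Poly_Mapping.lookup f \<gamma> \<noteq> 0})"

definition lattice_point :: "('v \<Rightarrow>\<^sub>0 real) \<Rightarrow> bool" where
  "lattice_point p \<longleftrightarrow> (\<forall>v. Poly_Mapping.lookup p v \<in> \<int>)"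

definition SNP :: "('v, 'a::zero) mpol \<Rightarrow> bool" where
  "SNP f \<longleftrightarrow> (\<forall>p \<in> newton_polytope f. lattice_point p \<longrightarrow>
                (\<exists>\<gamma>. p = real_exponent \<gamma> \<and> Poly_Mapping.lookup f \<gamma> \<noteq> 0))"

definition G_at_ones :: "nat list \<Rightarrow> nat \<Rightarrow> (nat, int) mpol" where
  "G_at_ones lam n = hybrid_G lam n pvar (\<lambda>_. 1) (\<lambda>_. 1)"

text \<open>With generic parameters the coefficients lie in the polynomial ring over the integers in
  the indeterminates \<open>t i\<close> (index \<open>Inl i\<close>) and \<open>w i\<close> (index \<open>Inr i\<close>).\<close>

definition G_generic :: "nat list \<Rightarrow> nat \<Rightarrow> (nat, (nat + nat, int) mpol) mpol" where
  "G_generic lam n =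
     hybrid_G lam n pvar (\<lambda>i. pconst (pvar (Inl i))) (\<lambda>i. pconst (pvar (Inr i)))"

end

theory Submission
  imports Defs
begin

text \<open>
  Let \<open>\<lambda>\<^sub>0 \<ge> \<lambda>\<^sub>1 \<ge> \<dots>\<close> be the row lengths and \<open>\<nu>\<^sub>i = min\<^sub>k\<^sub>\<le>\<^sub>i (\<lambda>\<^sub>k + k)\<close>. A vector \<open>r\<close> is the weight of a
  set-valued reverse plane partition with entries at most \<open>n\<close> if and only if \<open>r\<close> is supported on
  \<open>{1..n}\<close>, its total is at least \<open>\<lambda>\<^sub>0\<close>, and \<open>r(A) \<le> \<nu>\<^sub>0 + \<dots> + \<nu>\<^sub>a\<^sub>-\<^sub>1\<close> for every set \<open>A\<close> of \<open>a\<close>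
  letters. These are linear inequalities, so the support consists of all lattice points of a convex
  set, and since all coefficients are sums of monomials no cancellation occurs.

  The characterization is proved by induction on \<open>n\<close>. The boxes filled with \<open>{n}\<close> form a skew shape
  \<open>\<lambda>/\<mu>\<close>, and any other box containing \<open>n\<close> is a corner of \<open>\<mu>\<close>. Such a corner adds to the weight only
  if it is the bottom of its column in \<open>\<lambda>\<close>, and these corners may be chosen freely.
\<close>

section \<open>Shapes and the bounding sequence\<close>

primrec nu :: "(nat \<Rightarrow> nat) \<Rightarrow> nat \<Rightarrow> nat" where
  "nu L 0 = L 0"
| "nu L (Suc i) = min (nu L i) (L (Suc i) + Suc i)"

text \<open>For antitone \<open>L\<close> with finitely many rows and \<open>a \<ge> 1\<close>, this
  turns out to be the largest total weight of a filling with \<open>a\<close> letters. Thus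
  \<open>nu L i\<close> is the gain in that maximum from one letter more than
  \<open>i\<close>.\<close>

definition nu_sum :: "(nat \<Rightarrow> nat) \<Rightarrow> nat \<Rightarrow> nat" where
  "nu_sum L a = (\<Sum>i<a. nu L i)"

lemma nu_sum_Suc: "nu_sum L (Suc a) = nu_sum L a + nu L a"
  by (simp add: nu_sum_def)

lemma nu_sum_0: "nu_sum L 0 = 0"
  by (simp add: nu_sum_def)

lemma nu_le: "nu L i \<le> L i + i"
  by (cases i) auto

lemma nu_mono: "(\<And>i. M i \<le> L i) \<Longrightarrow> nu M a \<le> nu L a"
  by (induction a) (auto simp: min.coboundedI1 min.coboundedI2)

lemma nu_sum_mono: "(\<And>i. M i \<le> L i) \<Longrightarrow> nu_sum M a \<le> nu_sum L a"
  by (simp add: nu_sum_def nu_mono sum_mono)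

text \<open>Unlike in \<^const>\<open>SVRPP\<close>, rows are indexed from 0; columns are still indexed from 1.\<close>

definition fill :: "(nat \<Rightarrow> nat) \<Rightarrow> nat \<Rightarrow> (nat \<Rightarrow> nat \<Rightarrow> nat set) \<Rightarrow> bool" where
  "fill L n U \<longleftrightarrow>
     (\<forall>i j. U i j \<subseteq> {1..n}) \<and>
     (\<forall>i j. U i j \<noteq> {} \<longleftrightarrow> 1 \<le> j \<and> j \<le> L i) \<and>
     (\<forall>i j a b. a \<in> U i j \<longrightarrow> b \<in> U i (Suc j) \<longrightarrow> a \<le> b) \<and>
     (\<forall>i j a b. a \<in> U i j \<longrightarrow> b \<in> U (Suc i) j \<longrightarrow> a \<le> b)"

lemma fill_subset: "fill L n U \<Longrightarrow> U i j \<subseteq> {1..n}"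
  by (simp add: fill_def)

lemma fill_nonempty_iff: "fill L n U \<Longrightarrow> U i j \<noteq> {} \<longleftrightarrow> 1 \<le> j \<and> j \<le> L i"
  by (simp add: fill_def)

lemma fill_row: "fill L n U \<Longrightarrow> a \<in> U i j \<Longrightarrow> b \<in> U i (Suc j) \<Longrightarrow> a \<le> b"
  by (simp add: fill_def)

lemma fill_column: "fill L n U \<Longrightarrow> a \<in> U i j \<Longrightarrow> b \<in> U (Suc i) j \<Longrightarrow> a \<le> b"
  by (simp add: fill_def)

definition columns_with :: "(nat \<Rightarrow> nat \<Rightarrow> nat set) \<Rightarrow> nat \<Rightarrow> nat set" where
  "columns_with U k = {j. \<exists>i. k \<in> U i j}"

lemma columns_subset:
  assumes "antimono L" "fill L n U"
  shows "columns_with U k \<subseteq> {1..L 0}"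
proof
  fix j assume "j \<in> columns_with U k"
  then obtain i where "k \<in> U i j" by (auto simp: columns_with_def)
  then have "1 \<le> j \<and> j \<le> L i" using assms(2) unfolding fill_def by blast
  moreover have "L i \<le> L 0" using assms(1) by (simp add: antimonoD)
  ultimately show "j \<in> {1..L 0}" by simp
qed

text \<open>The boxes in between are nonempty, so the comparisons of neighbours chain through their
  elements.\<close>

lemma fill_row_le:
  assumes "fill L n U" "a \<in> U i j" "b \<in> U i j'" "j < j'"
  shows "a \<le> b"
  using assms(3,4)
proof (induction j' arbitrary: b)
  case (Suc j')
  show ?case
  proof (cases "j = j'")
    case True
    then show ?thesis using Suc.prems assms unfolding fill_def by blast
  next
    case False
    then have "j < j'" using Suc.prems by simp
    have "1 \<le> j" "Suc j' \<le> L i" using assms(1,2) Suc.prems unfolding fill_def by blast+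
    then have "U i j' \<noteq> {}" using assms(1) \<open>j < j'\<close> unfolding fill_def by auto
    then obtain c where c: "c \<in> U i j'" by blast
    then have "c \<le> b" using Suc.prems assms(1) unfolding fill_def by blast
    then show ?thesis using Suc.IH[OF c \<open>j < j'\<close>] by simp
  qed
qed simp

text \<open>As for rows; here antitonicity of \<open>L\<close> makes the boxes in between
  nonempty.\<close>

lemma fill_column_le:
  assumes "antimono L" "fill L n U" "a \<in> U i j" "b \<in> U i' j" "i < i'"
  shows "a \<le> b"
  using assms(4,5)
proof (induction i' arbitrary: b)
  case (Suc i')
  show ?case
  proof (cases "i = i'")
    case True
    then show ?thesis using Suc.prems assms unfolding fill_def by blast
  next
    case False
    then have "i < i'" using Suc.prems by simp
    have "1 \<le> j" "j \<le> L (Suc i')" using assms(2,3) Suc.prems unfolding fill_def by blast+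
    moreover have "L (Suc i') \<le> L i'" using assms(1) by (simp add: antimonoD)
    ultimately have "U i' j \<noteq> {}" using assms(2) unfolding fill_def by auto
    then obtain c where c: "c \<in> U i' j" by blast
    then have "c \<le> b" using Suc.prems assms(2) unfolding fill_def by blast
    then show ?thesis using Suc.IH[OF c \<open>i < i'\<close>] by simp
  qed
qed simp

section \<open>Removing the largest letter\<close>

text \<open>Deleting the letter \<open>Suc n\<close> from every box leaves a filling of a smaller
  shape \<open>M\<close>. The last two conclusions locate the deleted letter: in a column whose
  bottom box lies in row \<open>i\<close> it can occur only if the column is at or beyond the end of
  row \<open>i\<close> of \<open>M\<close>, and every column whose top box disappears contains
  it.\<close>

lemma fill_restrict:
  assumes L: "antimono L" and U: "fill L (Suc n) U"
  obtains M U' where "antimono M" "\<And>i. M i \<le> L i" "fill M n U'"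
    "\<And>k. k \<le> n \<Longrightarrow> columns_with U' k = columns_with U k"
    "\<And>i. columns_with U (Suc n) \<inter> {L (Suc i)<..L i} \<subseteq> {M i..L i}"
    "{M 0<..L 0} \<subseteq> columns_with U (Suc n)"
proof -
  define N where "N = Suc n"
  define U' where "U' = (\<lambda>i j. U i j - {N})"
  define M where "M = (\<lambda>i. card {j. U' i j \<noteq> {}})"
  have sub: "U i j \<subseteq> {1..N}" for i j using fill_subset[OF U] unfolding N_def .
  note ne = fill_nonempty_iff[OF U]
  have le_N: "a \<le> N" if "a \<in> U i j" for a i j using sub that by fastforce
  \<comment> \<open>A box emptied by the deletion was \<open>{N}\<close>; every entry further right
    is then at least \<open>N\<close>, so those boxes are emptied too.\<close>
  have left: "U' i j \<noteq> {}" if nonempty: "U' i j' \<noteq> {}" and "1 \<le> j" "j < j'" for i j j'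
  proof
    assume e: "U' i j = {}"
    obtain b where b: "b \<in> U i j'" "b \<noteq> N" using nonempty unfolding U'_def by auto
    have "U i j \<noteq> {}" using ne[of i j] ne[of i j'] b that by force
    then have "N \<in> U i j" using e unfolding U'_def by auto
    then have "N \<le> b" using fill_row_le[OF U _ b(1) \<open>j < j'\<close>] by blast
    then show False using le_N[OF b(1)] b(2) by simp
  qed
  have above: "U' i j \<noteq> {}" if nonempty: "U' (Suc i) j \<noteq> {}" for i j
  proof
    assume e: "U' i j = {}"
    obtain b where b: "b \<in> U (Suc i) j" "b \<noteq> N" using nonempty unfolding U'_def by auto
    have "L (Suc i) \<le> L i" using L by (simp add: antimonoD)
    then have "U i j \<noteq> {}" using ne[of i j] ne[of "Suc i" j] b by force
    then have "N \<in> U i j" using e unfolding U'_def by auto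
    then have "N \<le> b" using fill_column_le[OF L U _ b(1)] by blast
    then show False using le_N[OF b(1)] b(2) by simp
  qed
  have fin: "{j. U' i j \<noteq> {}} \<subseteq> {1..L i}" for i
    using ne[of i] unfolding U'_def by fastforce
  have rows: "{j. U' i j \<noteq> {}} = {1..M i}" for i
  proof (cases "{j. U' i j \<noteq> {}} = {}")
    case True then show ?thesis unfolding M_def by simp
  next
    case False
    let ?S = "{j. U' i j \<noteq> {}}"
    have f: "finite ?S" using fin finite_subset by blast
    have m: "Max ?S \<in> ?S" using f False Max_in by blast
    have "?S = {1..Max ?S}"
    proof
      show "?S \<subseteq> {1..Max ?S}" using f fin[of i] Max_ge[OF f] by fastforce
      show "{1..Max ?S} \<subseteq> ?S"
      proof
        fix j assume j: "j \<in> {1..Max ?S}"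
        show "j \<in> ?S"
        proof (cases "j = Max ?S")
          case True
          then show ?thesis using m by metis
        next
          case False
          then show ?thesis using m j left[of i "Max ?S" j] by simp
        qed
      qed
    qed
    then obtain q where q: "?S = {1..q}" ..
    have "M i = card {1..q}" unfolding M_def q ..
    then show ?thesis using q by simp
  qed
  have rows_iff: "U' i j \<noteq> {} \<longleftrightarrow> 1 \<le> j \<and> j \<le> M i" for i j
    using rows[of i] by auto
  have MleL: "M i \<le> L i" for i
    unfolding M_def using card_mono[OF _ fin[of i]] by simp
  have "M (Suc i) \<le> M i" for i
  proof -
    have "finite {j. U' i j \<noteq> {}}" using fin[of i] finite_subset by blast
    moreover have "{j. U' (Suc i) j \<noteq> {}} \<subseteq> {j. U' i j \<noteq> {}}" using above by blast
    ultimately show ?thesis unfolding M_def by (rule card_mono)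
  qed
  then have aM: "antimono M" by (simp add: antimono_iff_le_Suc)
  have fM: "fill M n U'"
    unfolding fill_def
  proof (intro conjI allI impI)
    show "U' i j \<subseteq> {1..n}" for i j using sub[of i j] unfolding U'_def N_def by fastforce
    show "U' i j \<noteq> {} \<longleftrightarrow> 1 \<le> j \<and> j \<le> M i" for i j by (rule rows_iff)
    show "a \<le> b" if "a \<in> U' i j" "b \<in> U' i (Suc j)" for i j a b
      using fill_row[OF U] that unfolding U'_def by (metis DiffD1)
    show "a \<le> b" if "a \<in> U' i j" "b \<in> U' (Suc i) j" for i j a b
      using fill_column[OF U] that unfolding U'_def by (metis DiffD1)
  qed
  have cols: "columns_with U' k = columns_with U k" if "k \<le> n" for k
    using that unfolding columns_with_def U'_def N_def by auto
  have corner: "columns_with U (Suc n) \<inter> {L (Suc i)<..L i} \<subseteq> {M i..L i}" for i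
  proof
    fix j assume j: "j \<in> columns_with U (Suc n) \<inter> {L (Suc i)<..L i}"
    then obtain i' where i': "N \<in> U i' j" by (auto simp: columns_with_def N_def)
    then have "1 \<le> j" "j \<le> L i'" using ne by blast+
    have "i' \<le> i"
    proof (rule ccontr)
      assume "\<not> i' \<le> i"
      then have "L i' \<le> L (Suc i)" using L by (simp add: antimonoD)
      then show False using \<open>j \<le> L i'\<close> j by simp
    qed
    \<comment> \<open>Row \<open>i\<close> holds the bottom box of column \<open>j\<close>. If
      \<open>N\<close> occurs in this column, the entries of that bottom box are all
      \<open>N\<close> or the box contains \<open>N\<close>, so no entry below \<open>N\<close> can
      stand at \<open>(i, Suc j)\<close>.\<close>
    have "M i \<le> j"
    proof (rule ccontr)
      assume "\<not> M i \<le> j"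
      then have "U' i (Suc j) \<noteq> {}" using rows_iff by simp
      then obtain b where b: "b \<in> U i (Suc j)" "b \<noteq> N" unfolding U'_def by blast
      have "U i j \<noteq> {}" using ne \<open>1 \<le> j\<close> j by auto
      then obtain c where c: "c \<in> U i j" by blast
      have "N \<le> b"
      proof (cases "i' = i")
        case True
        then show ?thesis using fill_row_le[OF U i'] b by auto
      next
        case False
        then have "N \<le> c" using fill_column_le[OF L U i' c] \<open>i' \<le> i\<close> by simp
        then show ?thesis using fill_row_le[OF U c b(1)] by simp
      qed
      then show False using le_N[OF b(1)] b(2) by simp
    qed
    then show "j \<in> {M i..L i}" using j by simp
  qed
  have "{M 0<..L 0} \<subseteq> columns_with U (Suc n)"
  proof
    fix j assume "j \<in> {M 0<..L 0}"
    then have "U 0 j \<noteq> {}" "U' 0 j = {}" using ne[of 0 j] rows_iff[of 0 j] by auto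
    then have "N \<in> U 0 j" unfolding U'_def by auto
    then show "j \<in> columns_with U (Suc n)" unfolding columns_with_def N_def by blast
  qed
  from that[OF aM MleL fM cols corner this] show thesis by simp
qed

text \<open>Every box of the skew shape \<open>L/M\<close> receives the new letter. If
  \<open>L (Suc i) < M i\<close>, the box \<open>(i, M i)\<close> ends its row in \<open>M\<close>
  and its column in \<open>L\<close>; adding the letter there is optional and gains exactly one
  column. Hence every \<open>p\<close> between the two counts is attained.\<close>

lemma fill_extend:
  assumes L: "antimono L" and M: "antimono M" and MleL: "\<And>i. M i \<le> L i" and U: "fill M n U"
    and fin: "finite {i. L (Suc i) < M i}"
    and lo: "card {j. \<exists>i. M i < j \<and> j \<le> L i} \<le> p"
    and hi: "p \<le> card {j. \<exists>i. M i < j \<and> j \<le> L i} + card {i. L (Suc i) < M i}"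
  obtains U' where "fill L (Suc n) U'" "\<And>k. k \<le> n \<Longrightarrow> columns_with U' k = columns_with U k"
    "card (columns_with U' (Suc n)) = p"
proof -
  define B where "B = {j. \<exists>i. M i < j \<and> j \<le> L i}"
  have finB: "finite B"
  proof (rule finite_subset)
    show "B \<subseteq> {..L 0}" using antimonoD[OF L, of 0] unfolding B_def by (auto intro: order_trans)
  qed simp
  have "p - card B \<le> card {i. L (Suc i) < M i}" using hi B_def by simp
  then obtain I where I: "I \<subseteq> {i. L (Suc i) < M i}" "card I = p - card B"
    by (meson obtain_subset_with_card_n)
  then have finI: "finite I" using fin finite_subset by blast
  have corner: "L (Suc i) < M i" if "i \<in> I" for i using I that by blast
  \<comment> \<open>Later rows of \<open>M\<close> end strictly further left, so distinct chosen
    corners lie in distinct columns.\<close>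
  have less: "M i' < M i" if "i \<in> I" "i < i'" for i i'
  proof -
    have "M i' \<le> L (Suc i)" using MleL[of i'] antimonoD[OF L, of "Suc i" i'] that by linarith
    then show ?thesis using corner that by fastforce
  qed
  have inj: "inj_on M I" using less by (metis inj_onI linorder_neqE_nat order_less_irrefl)
  \<comment> \<open>A chosen corner is the bottom of its column in \<open>L\<close>, so no skew box
    lies below it, and none lies above it since \<open>M\<close> is antitone.\<close>
  have disj: "B \<inter> M ` I = {}"
  proof (rule ccontr)
    assume "B \<inter> M ` I \<noteq> {}"
    then obtain i i' where i: "i \<in> I" "M i' < M i" "M i \<le> L i'" unfolding B_def by auto
    have "i' \<le> i"
      using i corner[OF i(1)] antimonoD[OF L, of "Suc i" i'] by (meson leD not_less_eq_eq order_trans)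
    then show False using i antimonoD[OF M, of i' i] by simp
  qed
  define U' where "U' = (\<lambda>i j. U i j \<union> (if M i < j \<and> j \<le> L i \<or> i \<in> I \<and> j = M i then {Suc n} else {}))"
  note sub = fill_subset[OF U]
  note ne = fill_nonempty_iff[OF U]
  note row = fill_row[OF U] and col = fill_column[OF U]
  have le: "a \<le> Suc n" if "a \<in> U' i j" for a i j
    using that sub[of i j] unfolding U'_def by (fastforce split: if_splits)
  have "fill L (Suc n) U'"
    unfolding fill_def
  proof (intro conjI allI impI)
    show "U' i j \<subseteq> {1..Suc n}" for i j
    proof -
      have "U i j \<subseteq> {1..Suc n}" by (rule order_trans[OF sub]) auto
      then show ?thesis unfolding U'_def by simp
    qed
    show "(U' i j \<noteq> {}) = (1 \<le> j \<and> j \<le> L i)" for i j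
      using ne[of i j] MleL[of i] corner[of i] unfolding U'_def by auto
    show "a \<le> b" if a: "a \<in> U' i j" and b: "b \<in> U' i (Suc j)" for i j a b
    proof (cases "b = Suc n")
      case False
      \<comment> \<open>An old entry at \<open>(i, Suc j)\<close> shows that \<open>(i, j)\<close>
        is not the end of its row in \<open>M\<close>, so it did not receive the new letter.\<close>
      then have b': "b \<in> U i (Suc j)" using b unfolding U'_def by (auto split: if_splits)
      then have "Suc j \<le> M i" using ne by blast
      then have "a \<in> U i j" using a unfolding U'_def by (auto split: if_splits)
      then show ?thesis using row b' by blast
    qed (use le[OF a] in simp)
    show "a \<le> b" if a: "a \<in> U' i j" and b: "b \<in> U' (Suc i) j" for i j a b
    proof (cases "b = Suc n")
      case False
      \<comment> \<open>An old entry below means \<open>j \<le> M (Suc i) \<le> L (Suc i)\<close>,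
        so \<open>(i, j)\<close> is neither a skew box nor a chosen corner.\<close>
      then have b': "b \<in> U (Suc i) j" using b unfolding U'_def by (auto split: if_splits)
      then have "j \<le> M (Suc i)" using ne by blast
      moreover have "M (Suc i) \<le> M i" using M by (simp add: antimonoD)
      ultimately have "a \<in> U i j"
        using a MleL[of "Suc i"] corner[of i] unfolding U'_def by (auto split: if_splits)
      then show ?thesis using col b' by blast
    qed (use le[OF a] in simp)
  qed
  moreover have "columns_with U' k = columns_with U k" if "k \<le> n" for k
    using that unfolding columns_with_def U'_def by auto
  moreover have "columns_with U' (Suc n) = B \<union> M ` I"
  proof -
    have "Suc n \<notin> U i j" for i j using sub[of i j] by auto
    then show ?thesis unfolding columns_with_def U'_def B_def by (auto split: if_splits)
  qed
  then have "card (columns_with U' (Suc n)) = card B + card I"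
    using card_Un_disjoint[OF finB _ disj] finI card_image[OF inj] by simp
  then have "card (columns_with U' (Suc n)) = p" using I lo B_def by simp
  ultimately show thesis using that by blast
qed

section \<open>Necessity\<close>

text \<open>Here \<open>A\<close> stands for the columns containing the largest letter and
  \<open>M\<close> for the shape left to the others. The bound turns the inequality for
  \<open>a\<close> letters on \<open>M\<close> into the one for \<open>Suc a\<close> letters on
  \<open>L\<close>.\<close>

lemma removed_columns_bound:
  assumes L: "antimono L" and MleL: "\<And>i. M i \<le> L i" and A: "A \<subseteq> {1..L 0}"
    and corner: "\<And>i. A \<inter> {L (Suc i)<..L i} \<subseteq> {M i..L i}"
  shows "card A + nu_sum M a \<le> nu_sum L (Suc a)"
proof -
  have finA: "finite A" using A finite_subset by blast
  \<comment> \<open>Strengthened for the induction: columns beyond \<open>L a\<close> are counted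
    exactly, the first \<open>L a\<close> columns as if all belonged to \<open>A\<close>.\<close>
  have "card (A \<inter> {L a<..}) + L a + nu_sum M a \<le> nu_sum L (Suc a)"
  proof (induction a)
    case 0
    have "A \<inter> {L 0<..} = {}" using A by auto
    then show ?case by (simp add: nu_sum_def)
  next
    case (Suc a)
    define x where "x = card (A \<inter> {L (Suc a)<..L a})"
    have La: "L (Suc a) \<le> L a" using L by (simp add: antimonoD)
    have "A \<inter> {L (Suc a)<..} = (A \<inter> {L a<..}) \<union> (A \<inter> {L (Suc a)<..L a})" using La by auto
    then have "card (A \<inter> {L (Suc a)<..}) \<le> card (A \<inter> {L a<..}) + x"
      unfolding x_def by (metis card_Un_le)
    \<comment> \<open>\<open>nu L (Suc a)\<close> is a minimum of two terms. This bound and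
      \<open>nu_mono\<close> handle \<open>nu L a\<close>; the next bound and \<open>nu_le\<close>
      handle \<open>L (Suc a) + Suc a\<close>. The \<open>Suc\<close> in the next bound allows for
      the corner column \<open>M a\<close>.\<close>
    moreover have "x \<le> L a - L (Suc a)"
      unfolding x_def using card_mono[of "{L (Suc a)<..L a}"] by (metis card_greaterThanAtMost finite_greaterThanAtMost inf_le2)
    moreover have "x \<le> Suc (L a) - M a"
      unfolding x_def using card_mono[OF _ corner[of a]] by simp
    moreover have "nu M a \<le> nu L a" using MleL by (rule nu_mono)
    moreover have "nu M a \<le> M a + a" by (rule nu_le)
    ultimately show ?case using Suc.IH La MleL[of a] by (auto simp: nu_sum_Suc min_def)
  qed
  moreover have "card A \<le> card (A \<inter> {L a<..}) + L a"
  proof -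
    have "A \<subseteq> (A \<inter> {L a<..}) \<union> {1..L a}" using A by fastforce
    then have "card A \<le> card ((A \<inter> {L a<..}) \<union> {1..L a})" using finA by (intro card_mono) auto
    also have "\<dots> \<le> card (A \<inter> {L a<..}) + card {1..L a}" by (rule card_Un_le)
    finally show ?thesis by simp
  qed
  ultimately show ?thesis by linarith
qed

text \<open>Induction on the largest letter. If \<open>A\<close> contains it,
  \<open>removed_columns_bound\<close> pays for its columns; otherwise \<open>nu_sum\<close> is
  monotone in the shape. For the lower bound, the letter occupies at least the columns lost from row
  0.\<close>

lemma weight_necessary:
  assumes "antimono L" "fill L n U"
  shows "L 0 \<le> (\<Sum>k\<in>{1..n}. card (columns_with U k)) \<and>
    (\<forall>A\<subseteq>{1..n}. (\<Sum>k\<in>A. card (columns_with U k)) \<le> nu_sum L (card A))"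
  using assms
proof (induction n arbitrary: L U)
  case 0
  \<comment> \<open>With no letters available, the last box of row 0 is empty, so the row has
    none.\<close>
  have "U 0 (L 0) = {}" using 0 unfolding fill_def by fastforce
  then have "L 0 = 0" using 0 unfolding fill_def by (metis One_nat_def Suc_leI order_refl neq0_conv)
  then show ?case by (auto simp: nu_sum_0)
next
  case (Suc n)
  define C where "C = columns_with U (Suc n)"
  obtain M U' where M: "antimono M" "\<And>i. M i \<le> L i" "fill M n U'"
    and eq: "\<And>k. k \<le> n \<Longrightarrow> columns_with U' k = columns_with U k"
    and corner: "\<And>i. C \<inter> {L (Suc i)<..L i} \<subseteq> {M i..L i}"
    and new: "{M 0<..L 0} \<subseteq> C"
    using fill_restrict[OF Suc.prems] unfolding C_def by metis
  have C: "C \<subseteq> {1..L 0}" unfolding C_def using columns_subset[OF Suc.prems] .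
  then have finC: "finite C" using finite_subset by blast
  note IH = Suc.IH[OF M(1,3)]
  have sum_eq: "(\<Sum>k\<in>A. card (columns_with U' k)) = (\<Sum>k\<in>A. card (columns_with U k))" if "A \<subseteq> {1..n}" for A
    using that eq by (intro sum.cong) auto
  show ?case
  proof (intro conjI allI impI)
    have "L 0 - M 0 \<le> card C" using card_mono[OF finC new] by simp
    then show "L 0 \<le> (\<Sum>k\<in>{1..Suc n}. card (columns_with U k))"
      using IH sum_eq[of "{1..n}"] unfolding C_def by simp linarith
  next
    fix A assume A: "A \<subseteq> {1..Suc n}"
    let ?A = "A - {Suc n}"
    have A': "?A \<subseteq> {1..n}" using A by fastforce
    have finA: "finite A" using A finite_subset by blast
    have b: "(\<Sum>k\<in>?A. card (columns_with U k)) \<le> nu_sum M (card ?A)"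
      unfolding sum_eq[OF A', symmetric] using IH A' by blast
    show "(\<Sum>k\<in>A. card (columns_with U k)) \<le> nu_sum L (card A)"
    proof (cases "Suc n \<in> A")
      case True
      have "(\<Sum>k\<in>A. card (columns_with U k)) = card C + (\<Sum>k\<in>?A. card (columns_with U k))"
        using sum.remove[OF finA True] by (simp add: C_def)
      also have "\<dots> \<le> card C + nu_sum M (card ?A)" using b by simp
      also have "\<dots> \<le> nu_sum L (Suc (card ?A))"
        using removed_columns_bound[OF Suc.prems(1) M(2) C corner] .
      also have "Suc (card ?A) = card A" using card_Suc_Diff1[OF finA True] .
      finally show ?thesis .
    next
      case False
      then show ?thesis using b nu_sum_mono[of M L, OF M(2)] by (simp add: order_trans)
    qed
  qed
qed

section \<open>Sufficiency\<close>

lemma nu_Suc_le: "nu L (Suc i) \<le> nu L i"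
  by simp

lemma le_nu_sum: "L 0 \<le> nu_sum L (Suc a)"
  by (induction a) (auto simp: nu_sum_def)

lemma sum_sub_choice:
  fixes y :: "nat \<Rightarrow> nat"
  assumes "q \<le> (\<Sum>i<l. y i)"
  obtains z where "\<And>i. z i \<le> y i" "(\<Sum>i<l. z i) = q"
proof -
  have "\<exists>z. (\<forall>i. z i \<le> y i) \<and> (\<Sum>i<l. z i) = q"
    using assms
  proof (induction l arbitrary: q)
    case 0
    then show ?case by (intro exI[of _ "\<lambda>_. 0"]) simp
  next
    case (Suc l)
    \<comment> \<open>Greedy choice: the last coordinate takes as much of \<open>q\<close> as it
      can.\<close>
    have "q - min q (y l) \<le> (\<Sum>i<l. y i)" using Suc.prems by auto
    then obtain z where z: "\<And>i. z i \<le> y i" "(\<Sum>i<l. z i) = q - min q (y l)"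
      using Suc.IH by blast
    have "(\<Sum>i<l. (z(l := min q (y l))) i) = (\<Sum>i<l. z i)" by (rule sum.cong) auto
    then show ?case using z by (intro exI[of _ "z(l := min q (y l))"]) auto
  qed
  then show thesis using that by blast
qed

text \<open>Chooses the shape left after placing the largest letter in \<open>p\<close> columns. The
  fifth conclusion preserves whatever the bounds on \<open>L\<close> imply for the remaining
  letters; the sixth prepares for \<open>truncated_shape\<close>.\<close>

lemma optimal_shape:
  assumes L: "antimono L" and l: "L l = 0" and p: "p \<le> L 0"
  obtains M where "antimono M" "\<And>i. M i \<le> L i"
    "card {j. \<exists>i. M i < j \<and> j \<le> L i} \<le> p"
    "p \<le> card {j. \<exists>i. M i < j \<and> j \<le> L i} + card {i. L (Suc i) < M i}"
    "\<And>a. nu_sum L a + min p (nu L a) \<le> nu_sum M a + p"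
    "p \<le> L 0 - M 0 + 1 + L 1"
proof -
  have Ls: "L (Suc i) \<le> L i" for i using L by (simp add: antimonoD)
  define eta where "eta i = nu L i + min p (nu L (Suc i)) - min p (nu L i)" for i
  \<comment> \<open>The sequence for which \<open>\<Sum>i<a. eta i\<close> is the minimum of \<open>nu_sum L a\<close> and \<open>nu_sum L (Suc a) - p\<close>.\<close>
  have eta_lo: "nu L (Suc i) \<le> eta i" and eta_hi: "eta i \<le> nu L i" for i
    using nu_Suc_le[of L i] unfolding eta_def by linarith+
  have sum_eta: "nu_sum L a + min p (nu L a) = (\<Sum>i<a. eta i) + p" for a
  proof (induction a)
    case 0
    show ?case using p by (simp add: nu_sum_def)
  next
    case (Suc a)
    then show ?case by (simp add: nu_sum_Suc eta_def del: nu.simps)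
  qed
  \<comment> \<open>At most \<open>y i\<close> boxes may leave row \<open>i\<close>: the subtracted
    1 keeps a corner beyond the next row, and the other term keeps \<open>M i + i\<close> at least
    \<open>eta i\<close>. \<open>g i\<close> counts that corner as an optional place for the
    letter.\<close>
  define y where "y i = min (L i - L (Suc i) - 1) (L i + i - eta i)" for i
  define g where "g i = (if L (Suc i) < L i then 1 else 0 :: nat)" for i
  have step: "L i + nu L (Suc i) \<le> y i + g i + eta i + L (Suc i)" for i
    using eta_lo[of i] eta_hi[of i] nu_le[of L i] nu_le[of L "Suc i"] Ls[of i]
    unfolding y_def g_def by auto
  \<comment> \<open>This is \<open>step\<close> telescoped. At \<open>a = l\<close>, where
    \<open>L l = 0\<close>, it says that the removable boxes together with the corners suffice for
    \<open>p\<close>.\<close>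
  have "p + nu L a \<le> (\<Sum>i<a. y i + g i) + L a + min p (nu L a)" for a
  proof (induction a)
    case 0
    show ?case using p by simp
  next
    case (Suc a)
    then show ?case using step[of a] nu_Suc_le[of L a]
      unfolding eta_def by (simp del: nu.simps)
  qed
  from this[of l] have "p \<le> (\<Sum>i<l. y i + g i)" using l by linarith
  then have py: "p \<le> (\<Sum>i<l. y i) + (\<Sum>i<l. g i)" by (simp add: sum.distrib)
  \<comment> \<open>Removed boxes are used first; what is missing from \<open>p\<close> is left to
    the corners, whose number does not depend on \<open>z\<close>.\<close>
  obtain z where zy: "\<And>i. z i \<le> y i" and z: "(\<Sum>i<l. z i) = min p (\<Sum>i<l. y i)"
    using sum_sub_choice[of "min p (\<Sum>i<l. y i)" y l] by auto
  define M where "M i = L i - z i" for i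
  have z1: "z i \<le> L i - L (Suc i) - 1" and z2: "z i \<le> L i + i - eta i" for i
    using zy[of i] unfolding y_def by simp_all
  have M_lo: "L (Suc i) \<le> M i" for i using z1[of i] Ls[of i] unfolding M_def by linarith
  have M_hi: "M i \<le> L i" for i unfolding M_def by simp
  have "M (Suc i) \<le> M i" for i using M_hi[of "Suc i"] M_lo[of i] by simp
  then have aM: "antimono M" by (simp add: antimono_iff_le_Suc)
  have nuM: "eta i \<le> nu M i" for i
  proof (induction i)
    case 0
    show ?case using z1[of 0] z2[of 0] eta_hi[of 0] unfolding M_def by simp
  next
    case (Suc i)
    have "eta (Suc i) \<le> eta i" using eta_lo[of i] eta_hi[of "Suc i"] by (rule order_trans[rotated])
    moreover have "eta (Suc i) \<le> M (Suc i) + Suc i"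
      using z1[of "Suc i"] z2[of "Suc i"] eta_hi[of "Suc i"] nu_le[of L "Suc i"]
      unfolding M_def by linarith
    ultimately show ?case using Suc by simp
  qed
  have nu_sum_M: "nu_sum L a + min p (nu L a) \<le> nu_sum M a + p" for a
    using sum_eta[of a] sum_mono[of "{..<a}" eta "nu M"] nuM by (simp add: nu_sum_def)
  define B where "B = {j. \<exists>i. M i < j \<and> j \<le> L i}"
  have L0: "L i = 0" if "l \<le> i" for i using antimonoD[OF L that] l by simp
  \<comment> \<open>\<open>M_lo\<close> makes the removed boxes a horizontal strip, so columns can
    be counted row by row.\<close>
  have "B = (\<Union>i\<in>{..<l}. {M i<..L i})"
  proof (intro set_eqI iffI)
    fix j assume "j \<in> B"
    then obtain i where i: "M i < j" "j \<le> L i" unfolding B_def by blast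
    then have "i < l" using L0[of i] by (cases "l \<le> i") auto
    then show "j \<in> (\<Union>i\<in>{..<l}. {M i<..L i})" using i by auto
  qed (auto simp: B_def)
  also have "card \<dots> = (\<Sum>i<l. card {M i<..L i})"
  proof (rule card_UN_disjoint)
    have "{M i<..L i} \<inter> {M j<..L j} = {}" if "i < j" for i j
      using M_lo[of i] antimonoD[OF L, of "Suc i" j] that by auto
    then show "\<forall>i\<in>{..<l}. \<forall>j\<in>{..<l}. i \<noteq> j \<longrightarrow> {M i<..L i} \<inter> {M j<..L j} = {}"
      by (metis Int_commute linorder_neqE_nat)
  qed auto
  also have "\<dots> = (\<Sum>i<l. z i)"
  proof (rule sum.cong)
    show "card {M i<..L i} = z i" for i using z1[of i] unfolding M_def by simp
  qed simp
  finally have cB: "card B = (\<Sum>i<l. z i)" .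
  have "{i. L (Suc i) < M i} = {i\<in>{..<l}. L (Suc i) < L i}"
  proof (intro set_eqI iffI)
    fix i assume "i \<in> {i. L (Suc i) < M i}"
    then have "L (Suc i) < L i" using M_hi[of i] by simp
    moreover have "i < l" using L0[of i] calculation by fastforce
    ultimately show "i \<in> {i\<in>{..<l}. L (Suc i) < L i}" by simp
  next
    fix i assume "i \<in> {i\<in>{..<l}. L (Suc i) < L i}"
    then show "i \<in> {i. L (Suc i) < M i}" using z1[of i] unfolding M_def by auto
  qed
  then have cG: "card {i. L (Suc i) < M i} = (\<Sum>i<l. g i)"
    unfolding g_def by (simp add: sum.If_cases Int_def)
  have pz: "p \<le> (\<Sum>i<l. z i) + (\<Sum>i<l. g i)" using z py by linarith
  \<comment> \<open>Each row after row 0 contributes at most \<open>L i - L (Suc i)\<close>, which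
    telescopes to \<open>L 1\<close>.\<close>
  have "(\<Sum>i<Suc a. z i + g i) + L (Suc a) \<le> z 0 + 1 + L 1" for a
  proof (induction a)
    case 0
    show ?case by (simp add: g_def)
  next
    case (Suc a)
    then show ?case using z1[of "Suc a"] Ls[of "Suc a"] by (auto simp: g_def)
  qed
  from this[of l] have "(\<Sum>i<l. z i) + (\<Sum>i<l. g i) \<le> z 0 + 1 + L 1"
    by (simp add: sum.distrib)
  then have "p \<le> L 0 - M 0 + 1 + L 1" using pz z1[of 0] unfolding M_def by linarith
  moreover have "card B \<le> p" using cB z by simp
  moreover have "p \<le> card B + card {i. L (Suc i) < M i}" using cB cG pz by simp
  ultimately show thesis using that[OF aM M_hi _ _ nu_sum_M] unfolding B_def by blast
qed

text \<open>Covers the case in which the weight left for the smaller letters, \<open>R\<close>, does not suffice to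
  fill the first row of the shape from \<open>optimal_shape\<close>.\<close>

lemma truncated_shape:
  fixes L :: "nat \<Rightarrow> nat"
  assumes L: "antimono L" and R: "R \<le> L 0" "L 0 \<le> R + p" and p: "p \<le> L 0" "p \<le> L 0 - R + L 1"
  obtains M where "antimono M" "\<And>i. M i \<le> L i" "card {j. \<exists>i. M i < j \<and> j \<le> L i} = p" "M 0 = R"
proof -
  \<comment> \<open>Shortening row 0 to \<open>R\<close> yields \<open>L 0 - R\<close> columns. Of
    the \<open>m\<close> columns up to \<open>R\<close> that reach row 1, the last \<open>w\<close>
    supply the rest by losing all boxes below row 0.\<close>
  define m w where "m = min R (L 1)" and "w = p - (L 0 - R)"
  have w: "w \<le> m" using R p unfolding m_def w_def by linarith
  define M where "M i = (if i = 0 then R else min (L i) (m - w))" for i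
  have Ls: "L (Suc i) \<le> L i" for i using L by (simp add: antimonoD)
  have "M (Suc i) \<le> M i" for i using Ls[of i] unfolding M_def m_def by auto
  then have aM: "antimono M" by (simp add: antimono_iff_le_Suc)
  have M_hi: "M i \<le> L i" for i using R unfolding M_def by simp
  have L1: "L 1 \<le> L 0" using Ls[of 0] by simp
  have "{j. \<exists>i. M i < j \<and> j \<le> L i} = {R<..L 0} \<union> {m - w<..m}"
  proof (intro set_eqI iffI)
    fix j assume "j \<in> {j. \<exists>i. M i < j \<and> j \<le> L i}"
    then obtain i where i: "M i < j" "j \<le> L i" by blast
    show "j \<in> {R<..L 0} \<union> {m - w<..m}"
    proof (cases "i = 0")
      case True
      then show ?thesis using i by (simp add: M_def)
    next
      case False
      then have "L i \<le> L 1" using antimonoD[OF L, of 1 i] by simp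
      then show ?thesis using i False L1 by (auto simp: M_def m_def)
    qed
  next
    fix j assume "j \<in> {R<..L 0} \<union> {m - w<..m}"
    then have "M 0 < j \<and> j \<le> L 0 \<or> M 1 < j \<and> j \<le> L 1" by (auto simp: M_def m_def)
    then show "j \<in> {j. \<exists>i. M i < j \<and> j \<le> L i}" by blast
  qed
  moreover have "{R<..L 0} \<inter> {m - w<..m} = {}" unfolding m_def by auto
  ultimately have "card {j. \<exists>i. M i < j \<and> j \<le> L i} = L 0 - R + (m - (m - w))"
    by (simp add: card_Un_disjoint)
  also have "\<dots> = p" using w R unfolding w_def by simp
  finally show thesis using that[OF aM M_hi] by (simp add: M_def)
qed

text \<open>Induction on the largest letter: a shape \<open>M\<close> is found whose conditions hold
  for the smaller letters, and \<open>fill_extend\<close> then adds the largest one. The zero row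
  \<open>l\<close> makes the number of corners finite.\<close>

lemma weight_sufficient:
  assumes "antimono L" "L l = 0" "L 0 \<le> (\<Sum>k\<in>{1..n}. r k)"
    "\<And>A. A \<subseteq> {1..n} \<Longrightarrow> (\<Sum>k\<in>A. r k) \<le> nu_sum L (card A)"
  shows "\<exists>U. fill L n U \<and> (\<forall>k\<in>{1..n}. card (columns_with U k) = r k)"
  using assms
proof (induction n arbitrary: L l)
  case 0
  have "L i = 0" for i using antimonoD[OF 0(1), of 0 i] 0(3) by simp
  then show ?case by (intro exI[of _ "\<lambda>_ _. {}"]) (auto simp: fill_def)
next
  case (Suc n)
  note L = Suc.prems(1)
  define p where "p = r (Suc n)"
  define R where "R = (\<Sum>k\<in>{1..n}. r k)"
  have R: "L 0 \<le> R + p" using Suc.prems(3) by (simp add: R_def p_def)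
  have p: "p \<le> L 0" using Suc.prems(4)[of "{Suc n}"] by (simp add: nu_sum_def p_def)
  \<comment> \<open>Combines the bounds for \<open>A\<close> and for \<open>A\<close> with the
    largest letter added, in the form matching \<open>optimal_shape\<close>.\<close>
  have b: "(\<Sum>k\<in>A. r k) + p \<le> nu_sum L (card A) + min p (nu L (card A))" if "A \<subseteq> {1..n}" for A
  proof -
    have A: "finite A" "Suc n \<notin> A" using that finite_subset by fastforce+
    have "(\<Sum>k\<in>A. r k) \<le> nu_sum L (card A)" using Suc.prems(4)[of A] that by fastforce
    moreover have "(\<Sum>k\<in>insert (Suc n) A. r k) \<le> nu_sum L (card (insert (Suc n) A))"
      by (rule Suc.prems(4)) (use that in fastforce)
    ultimately show ?thesis using A by (simp add: nu_sum_Suc p_def)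
  qed
  obtain M where M: "antimono M" "\<And>i. M i \<le> L i"
    "card {j. \<exists>i. M i < j \<and> j \<le> L i} \<le> p"
    "p \<le> card {j. \<exists>i. M i < j \<and> j \<le> L i} + card {i. L (Suc i) < M i}"
    and M0: "M 0 \<le> R" and bM: "\<And>A. A \<subseteq> {1..n} \<Longrightarrow> (\<Sum>k\<in>A. r k) \<le> nu_sum M (card A)"
  proof -
    obtain M where M: "antimono M" "\<And>i. M i \<le> L i"
      "card {j. \<exists>i. M i < j \<and> j \<le> L i} \<le> p"
      "p \<le> card {j. \<exists>i. M i < j \<and> j \<le> L i} + card {i. L (Suc i) < M i}"
      "\<And>a. nu_sum L a + min p (nu L a) \<le> nu_sum M a + p"
      "p \<le> L 0 - M 0 + 1 + L 1"
      by (rule optimal_shape[OF L Suc.prems(2) p]) (rule that)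
    show thesis
    proof (cases "M 0 \<le> R")
      case True
      show thesis
      proof (rule that[OF M(1-4) True])
        fix A :: "nat set" assume "A \<subseteq> {1..n}"
        then show "(\<Sum>k\<in>A. r k) \<le> nu_sum M (card A)" using b[of A] M(5)[of "card A"] by simp
      qed
    next
      case False
      \<comment> \<open>Since \<open>R < M 0\<close>, the summand 1 in \<open>M(6)\<close> is
        absorbed when \<open>M 0\<close> is replaced by \<open>R\<close>.\<close>
      then have "R \<le> L 0" "p \<le> L 0 - R + L 1" using M(2)[of 0] M(6) by linarith+
      then obtain N where N: "antimono N" "\<And>i. N i \<le> L i"
        "card {j. \<exists>i. N i < j \<and> j \<le> L i} = p" "N 0 = R"
        by (rule truncated_shape[OF L _ R p]) (rule that)
      \<comment> \<open>The first term of \<open>nu_sum N\<close> is already the full remaining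
        weight \<open>R\<close>.\<close>
      have "(\<Sum>k\<in>A. r k) \<le> nu_sum N (card A)" if A: "A \<subseteq> {1..n}" for A
      proof (cases "A = {}")
        case False
        have "finite A" using A finite_subset by blast
        then obtain a where a: "card A = Suc a" using False by (metis card_eq_0_iff not0_implies_Suc)
        have "(\<Sum>k\<in>A. r k) \<le> R" unfolding R_def using A by (intro sum_mono2) auto
        then show ?thesis using le_nu_sum[of N a] N(4) a by simp
      qed simp
      then show thesis using that[OF N(1,2)] N(3,4) by simp
    qed
  qed
  have "M l = 0" using M(2)[of l] Suc.prems(2) by simp
  then obtain U where U: "fill M n U" "\<forall>k\<in>{1..n}. card (columns_with U k) = r k"
    using Suc.IH[OF M(1) _ M0[unfolded R_def] bM] by blast
  have "i < l" if "L (Suc i) < M i" for i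
    using that M(2)[of i] antimonoD[OF L, of l i] Suc.prems(2) by (metis leI le_zero_eq not_less_zero order_less_le_trans)
  then have "finite {i. L (Suc i) < M i}" by (auto intro: finite_subset[of _ "{..<l}"])
  then obtain U' where U': "fill L (Suc n) U'" "\<And>k. k \<le> n \<Longrightarrow> columns_with U' k = columns_with U k"
    "card (columns_with U' (Suc n)) = p"
    using fill_extend[OF L M(1,2) U(1) _ M(3,4)] by metis
  have "card (columns_with U' k) = r k" if "k \<in> {1..Suc n}" for k
    using that U' U(2) p_def by (cases "k = Suc n") auto
  then show ?case using U'(1) by blast
qed

section \<open>The support of the polynomials\<close>

lemma lookup_scaleR:
  "Poly_Mapping.lookup (c *\<^sub>R p) v = c * Poly_Mapping.lookup p v" for p :: "'v \<Rightarrow>\<^sub>0 real"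
proof -
  have "{v. c *\<^sub>R Poly_Mapping.lookup p v \<noteq> 0} \<subseteq> Poly_Mapping.keys p"
    by (auto simp: in_keys_iff)
  then have "finite {v. c *\<^sub>R Poly_Mapping.lookup p v \<noteq> 0}"
    using finite_keys finite_subset by blast
  then show ?thesis by (simp add: scaleR_poly_mapping_def)
qed

lemma lookup_real_exponent: "Poly_Mapping.lookup (real_exponent \<gamma>) v = real (Poly_Mapping.lookup \<gamma> v)"
  by (simp add: real_exponent_def map.rep_eq when_def)

text \<open>The inequalities cut out a convex set \<open>Q\<close> containing the support, hence the
  Newton polytope. A lattice point of \<open>Q\<close> has nonnegative integer coordinates and
  satisfies the same inequalities, so it is an exponent of \<open>f\<close>.\<close>

lemma SNP_if_support_inequalities:
  fixes b :: "'v set \<Rightarrow> nat" and f :: "('v, 'a::zero) mpol"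
  assumes supp: "\<And>\<gamma>. Poly_Mapping.lookup f \<gamma> \<noteq> 0 \<longleftrightarrow>
      (\<forall>v. v \<notin> V \<longrightarrow> Poly_Mapping.lookup \<gamma> v = 0) \<and> c \<le> (\<Sum>v\<in>V. Poly_Mapping.lookup \<gamma> v) \<and>
      (\<forall>A\<subseteq>V. (\<Sum>v\<in>A. Poly_Mapping.lookup \<gamma> v) \<le> b A)"
  shows "SNP f"
proof -
  define Q :: "('v \<Rightarrow>\<^sub>0 real) set" where
    "Q = {p. (\<forall>v. 0 \<le> Poly_Mapping.lookup p v) \<and> (\<forall>v. v \<notin> V \<longrightarrow> Poly_Mapping.lookup p v = 0) \<and>
          real c \<le> (\<Sum>v\<in>V. Poly_Mapping.lookup p v) \<and>
          (\<forall>A\<subseteq>V. (\<Sum>v\<in>A. Poly_Mapping.lookup p v) \<le> real (b A))}"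
  have sum_eq: "(\<Sum>v\<in>A. Poly_Mapping.lookup (s *\<^sub>R p + t *\<^sub>R q) v) =
      s * (\<Sum>v\<in>A. Poly_Mapping.lookup p v) + t * (\<Sum>v\<in>A. Poly_Mapping.lookup q v)"
    for s t and p q :: "'v \<Rightarrow>\<^sub>0 real" and A
    by (simp add: lookup_add lookup_scaleR sum.distrib sum_distrib_left)
  have "convex Q"
  proof (rule convexI)
    fix p q :: "'v \<Rightarrow>\<^sub>0 real" and s t :: real
    assume p: "p \<in> Q" and q: "q \<in> Q" and st: "0 \<le> s" "0 \<le> t" "s + t = 1"
    have "real c \<le> s * (\<Sum>v\<in>V. Poly_Mapping.lookup p v) + t * (\<Sum>v\<in>V. Poly_Mapping.lookup q v)"
    proof -
      have "s * real c + t * real c \<le>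
          s * (\<Sum>v\<in>V. Poly_Mapping.lookup p v) + t * (\<Sum>v\<in>V. Poly_Mapping.lookup q v)"
        using p q st unfolding Q_def by (intro add_mono mult_left_mono) auto
      then show ?thesis using st by (simp add: distrib_right[symmetric])
    qed
    moreover have "s * (\<Sum>v\<in>A. Poly_Mapping.lookup p v) + t * (\<Sum>v\<in>A. Poly_Mapping.lookup q v)
        \<le> real (b A)" if "A \<subseteq> V" for A
      using p q st that unfolding Q_def by (intro convex_bound_le) auto
    ultimately show "s *\<^sub>R p + t *\<^sub>R q \<in> Q"
      using p q st unfolding Q_def mem_Collect_eq sum_eq by (simp add: lookup_add lookup_scaleR)
  qed
  moreover have "real_exponent ` {\<gamma>. Poly_Mapping.lookup f \<gamma> \<noteq> 0} \<subseteq> Q"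
    unfolding Q_def supp by (auto simp: lookup_real_exponent simp flip: of_nat_sum)
  ultimately have sub: "newton_polytope f \<subseteq> Q"
    unfolding newton_polytope_def by (rule hull_minimal[rotated])
  show ?thesis
    unfolding SNP_def
  proof (intro ballI impI)
    fix p assume "p \<in> newton_polytope f" and lat: "lattice_point p"
    then have p: "p \<in> Q" using sub by blast
    define \<gamma> where "\<gamma> = Poly_Mapping.map (\<lambda>x. nat \<lfloor>x\<rfloor>) p"
    have eq: "real (Poly_Mapping.lookup \<gamma> v) = Poly_Mapping.lookup p v" for v
    proof -
      have "Poly_Mapping.lookup p v \<in> \<int>" "0 \<le> Poly_Mapping.lookup p v"
        using lat p unfolding lattice_point_def Q_def by auto
      then show ?thesis by (auto simp: \<gamma>_def map.rep_eq when_def elim!: Ints_cases)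
    qed
    have "p = real_exponent \<gamma>" by (rule poly_mapping_eqI) (simp add: lookup_real_exponent eq)
    moreover have "Poly_Mapping.lookup f \<gamma> \<noteq> 0"
      using p unfolding supp Q_def by (simp flip: eq of_nat_sum)
    ultimately show "\<exists>\<gamma>. p = real_exponent \<gamma> \<and> Poly_Mapping.lookup f \<gamma> \<noteq> 0" by blast
  qed
qed

section \<open>Translation between set-valued reverse plane partitions and fillings\<close>

definition row_length :: "nat list \<Rightarrow> nat \<Rightarrow> nat" where
  "row_length lam i = (if i < length lam then lam ! i else 0)"

lemma antimono_row_length: "is_partition lam \<Longrightarrow> antimono (row_length lam)"
  by (auto simp: antimono_iff_le_Suc row_length_def is_partition_def
      dest: sorted_wrt_nth_less[of _ lam n "Suc n" for n])

text \<open>Rows past the last have length 0, so \<open>1 \<le> j\<close> already forces the row to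
  exist.\<close>

lemma diagram_iff: "(i, j) \<in> diagram lam \<longleftrightarrow> 1 \<le> i \<and> 1 \<le> j \<and> j \<le> row_length lam (i - 1)"
  by (auto simp: diagram_def row_length_def)

lemma set_le_iff:
  assumes "finite A" "A \<noteq> {}" "finite B" "B \<noteq> {}"
  shows "set_le A B \<longleftrightarrow> (\<forall>a\<in>A. \<forall>b\<in>B. a \<le> b)"
  using assms by (auto simp: set_le_def)

lemma SVRPP_upto_imp_fill:
  assumes T: "T \<in> SVRPP_upto n lam"
  shows "fill (row_length lam) n (\<lambda>i j. T (Suc i, j))"
    and "ircont lam T k = card (columns_with (\<lambda>i j. T (Suc i, j)) k)"
proof -
  have box: "finite (T x)" "T x \<noteq> {}" if "x \<in> diagram lam" for x
    using T that by (auto simp: SVRPP_upto_def SVRPP_def)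
  have off: "x \<in> diagram lam" if "T x \<noteq> {}" for x
    using T that unfolding SVRPP_upto_def SVRPP_def by blast
  have sub: "T x \<subseteq> {1..n}" for x
    using T off[of x] by (cases "T x = {}") (auto simp: SVRPP_upto_def)
  have row: "a \<le> b" if "a \<in> T (i, j)" "b \<in> T (i, Suc j)" for i j a b
  proof -
    have "(i, j) \<in> diagram lam" "(i, Suc j) \<in> diagram lam" using off that by blast+
    moreover from this have "set_le (T (i, j)) (T (i, Suc j))"
      using T by (auto simp: SVRPP_upto_def SVRPP_def)
    ultimately show ?thesis using that box set_le_iff by metis
  qed
  have col: "a \<le> b" if "a \<in> T (i, j)" "b \<in> T (Suc i, j)" for i j a b
  proof -
    have "(i, j) \<in> diagram lam" "(Suc i, j) \<in> diagram lam" using off that by blast+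
    moreover from this have "set_le (T (i, j)) (T (Suc i, j))"
      using T by (auto simp: SVRPP_upto_def SVRPP_def)
    ultimately show ?thesis using that box set_le_iff by metis
  qed
  show "fill (row_length lam) n (\<lambda>i j. T (Suc i, j))"
    unfolding fill_def
  proof (intro conjI allI impI)
    show "(T (Suc i, j) \<noteq> {}) = (1 \<le> j \<and> j \<le> row_length lam i)" for i j
    proof -
      have "T (Suc i, j) \<noteq> {} \<longleftrightarrow> (Suc i, j) \<in> diagram lam" using box(2) off by blast
      then show ?thesis by (simp add: diagram_iff)
    qed
    show "T (Suc i, j) \<subseteq> {1..n}" for i j by (rule sub)
    show "a \<le> b" if "a \<in> T (Suc i, j)" "b \<in> T (Suc i, Suc j)" for i j a b using row that .
    show "a \<le> b" if "a \<in> T (Suc i, j)" "b \<in> T (Suc (Suc i), j)" for i j a b using col that .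
  qed
  have "{j. \<exists>i. (i, j) \<in> diagram lam \<and> k \<in> T (i, j)} = columns_with (\<lambda>i j. T (Suc i, j)) k"
  proof (intro set_eqI iffI)
    fix j assume "j \<in> {j. \<exists>i. (i, j) \<in> diagram lam \<and> k \<in> T (i, j)}"
    then obtain i where i: "(i, j) \<in> diagram lam" "k \<in> T (i, j)" by blast
    then obtain i' where "i = Suc i'" by (cases i) (auto simp: diagram_iff)
    then show "j \<in> columns_with (\<lambda>i j. T (Suc i, j)) k" using i by (auto simp: columns_with_def)
  next
    fix j assume "j \<in> columns_with (\<lambda>i j. T (Suc i, j)) k"
    then obtain i where i: "k \<in> T (Suc i, j)" by (auto simp: columns_with_def)
    then have "(Suc i, j) \<in> diagram lam" by (intro off) auto
    then show "j \<in> {j. \<exists>i. (i, j) \<in> diagram lam \<and> k \<in> T (i, j)}" using i by blast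
  qed
  then show "ircont lam T k = card (columns_with (\<lambda>i j. T (Suc i, j)) k)"
    by (simp add: ircont_def)
qed

lemma fill_imp_SVRPP_upto:
  assumes U: "fill (row_length lam) n U"
  obtains T where "T \<in> SVRPP_upto n lam" "(\<lambda>i j. T (Suc i, j)) = U"
proof -
  \<comment> \<open>Rows of \<open>T\<close> are numbered from 1, so its row 0 is empty.\<close>
  define T where "T = (\<lambda>(i, j). case i of 0 \<Rightarrow> {} | Suc i' \<Rightarrow> U i' j)"
  have T_Suc: "T (Suc i, j) = U i j" for i j by (simp add: T_def)
  have sub: "T x \<subseteq> {1..n}" for x
    using fill_subset[OF U] by (auto simp: T_def split: prod.split nat.split)
  have fin: "finite (T x)" for x using sub finite_subset by blast
  have ne: "T x \<noteq> {} \<longleftrightarrow> x \<in> diagram lam" for x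
  proof (cases x)
    case (Pair i j)
    then show ?thesis
      using fill_nonempty_iff[OF U] by (cases i) (simp_all add: T_def diagram_iff)
  qed
  have row: "a \<le> b" if "a \<in> T (i, j)" "b \<in> T (i, Suc j)" for i j a b
    using that fill_row[OF U] by (cases i) (auto simp: T_def)
  have col: "a \<le> b" if "a \<in> T (i, j)" "b \<in> T (Suc i, j)" for i j a b
    using that fill_column[OF U] by (cases i) (auto simp: T_def)
  have "T \<in> SVRPP lam"
    unfolding SVRPP_def mem_Collect_eq
  proof (intro conjI allI ballI impI)
    fix i j
    show "set_le (T (i, j)) (T (i, j + 1))" if "(i, j) \<in> diagram lam \<and> (i, j + 1) \<in> diagram lam"
      using set_le_iff[OF fin _ fin] ne that row by auto
    show "set_le (T (i, j)) (T (i + 1, j))" if "(i, j) \<in> diagram lam \<and> (i + 1, j) \<in> diagram lam"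
      using set_le_iff[OF fin _ fin] ne that col by auto
  next
    fix x
    show "0 \<notin> T x" using sub[of x] by auto
    show "finite (T x)" by (rule fin)
    show "T x \<noteq> {}" if "x \<in> diagram lam" using that ne by blast
    show "T x = {}" if "x \<notin> diagram lam" using that ne by blast
  qed
  then have "T \<in> SVRPP_upto n lam" using sub by (simp add: SVRPP_upto_def)
  then show thesis using that T_Suc by blast
qed

section \<open>Attained exponent vectors\<close>

definition exponent :: "nat \<Rightarrow> (nat \<Rightarrow> nat) \<Rightarrow> (nat \<Rightarrow>\<^sub>0 nat)" where
  "exponent n \<alpha> = (\<Sum>k\<in>{1..n}. Poly_Mapping.single k (\<alpha> k))"

lemma lookup_exponent: "Poly_Mapping.lookup (exponent n \<alpha>) k = (if k \<in> {1..n} then \<alpha> k else 0)"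
  by (simp add: exponent_def lookup_sum lookup_single when_def)

lemma SVRPP_upto_exponent_iff:
  assumes lam: "is_partition lam"
  shows "(\<exists>T\<in>SVRPP_upto n lam. exponent n (ircont lam T) = \<gamma>) \<longleftrightarrow>
    (\<forall>k. k \<notin> {1..n} \<longrightarrow> Poly_Mapping.lookup \<gamma> k = 0) \<and>
    row_length lam 0 \<le> (\<Sum>k\<in>{1..n}. Poly_Mapping.lookup \<gamma> k) \<and>
    (\<forall>A\<subseteq>{1..n}. (\<Sum>k\<in>A. Poly_Mapping.lookup \<gamma> k) \<le> nu_sum (row_length lam) (card A))"
  (is "?L \<longleftrightarrow> ?R")
proof
  assume ?L
  then obtain T where T: "T \<in> SVRPP_upto n lam" and \<gamma>: "\<gamma> = exponent n (ircont lam T)" by blast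
  define U where "U = (\<lambda>i j. T (Suc i, j))"
  have "(\<Sum>k\<in>A. Poly_Mapping.lookup \<gamma> k) = (\<Sum>k\<in>A. card (columns_with U k))" if "A \<subseteq> {1..n}" for A
    using that by (intro sum.cong) (auto simp: \<gamma> lookup_exponent SVRPP_upto_imp_fill(2)[OF T] U_def)
  moreover have "fill (row_length lam) n U" unfolding U_def by (rule SVRPP_upto_imp_fill(1)[OF T])
  moreover have "\<forall>k. k \<notin> {1..n} \<longrightarrow> Poly_Mapping.lookup \<gamma> k = 0" by (simp add: \<gamma> lookup_exponent)
  ultimately show ?R
    using weight_necessary[OF antimono_row_length[OF lam], of n U] by simp
next
  assume R: ?R
  have "row_length lam (length lam) = 0" by (simp add: row_length_def)
  then obtain U where U: "fill (row_length lam) n U"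
      "\<forall>k\<in>{1..n}. card (columns_with U k) = Poly_Mapping.lookup \<gamma> k"
    using weight_sufficient[OF antimono_row_length[OF lam], of "length lam" "Poly_Mapping.lookup \<gamma>" n] R
    by blast
  obtain T where T: "T \<in> SVRPP_upto n lam" "(\<lambda>i j. T (Suc i, j)) = U"
    using fill_imp_SVRPP_upto[OF U(1)] .
  have "exponent n (ircont lam T) = \<gamma>"
    using U(2) R by (intro poly_mapping_eqI) (simp add: lookup_exponent SVRPP_upto_imp_fill(2)[OF T(1)] T(2))
  then show ?L using T(1) by blast
qed

section \<open>Coefficients and absence of cancellation\<close>

lemma pvar_power: "pvar v ^ m = Poly_Mapping.single (Poly_Mapping.single v m) 1"
  by (induction m) (simp_all add: pvar_def mult_single single_add[symmetric])

lemma prod_single: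
  "(\<Prod>k\<in>S. Poly_Mapping.single (e k) 1) =
    (Poly_Mapping.single (\<Sum>k\<in>S. e k) 1 :: 'b::comm_monoid_add \<Rightarrow>\<^sub>0 'a::comm_semiring_1)"
  by (induction S rule: infinite_finite_induct) (simp_all add: mult_single)

lemma mono_pow_pvar:
  assumes "\<And>k. \<alpha> k \<noteq> 0 \<Longrightarrow> k \<in> {1..n}"
  shows "mono_pow pvar \<alpha> = Poly_Mapping.single (exponent n \<alpha>) 1"
proof -
  have "(\<Sum>k | \<alpha> k \<noteq> 0. Poly_Mapping.single k (\<alpha> k)) = exponent n \<alpha>"
    unfolding exponent_def using assms by (intro sum.mono_neutral_left) auto
  then show ?thesis by (simp add: mono_pow_def pvar_power prod_single)
qed

lemma ircont_nonzero:
  assumes "T \<in> SVRPP_upto n lam" "ircont lam T k \<noteq> 0"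
  shows "k \<in> {1..n}"
proof -
  have "{j. \<exists>i. (i, j) \<in> diagram lam \<and> k \<in> T (i, j)} \<noteq> {}"
    using assms(2) unfolding ircont_def by (metis card.empty)
  then show ?thesis using assms(1) unfolding SVRPP_upto_def by blast
qed

text \<open>By \<open>c\<close>, the parameter monomials are constants as polynomials in the x
  variables, so each tableau contributes a single term.\<close>

lemma lookup_hybrid_G:
  fixes t w :: "nat \<Rightarrow> (nat, 'a::comm_semiring_1) mpol"
  assumes c: "\<And>T. T \<in> SVRPP_upto n lam \<Longrightarrow>
      mono_pow t (ceq lam T) * mono_pow w (ex lam T) = Poly_Mapping.single 0 (c T)"
  shows "Poly_Mapping.lookup (hybrid_G lam n pvar t w) \<gamma> =
    sum c {T \<in> SVRPP_upto n lam. exponent n (ircont lam T) = \<gamma>}"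
proof -
  have "hybrid_G lam n pvar t w =
      (\<Sum>T\<in>SVRPP_upto n lam. Poly_Mapping.single (exponent n (ircont lam T)) (c T))"
    unfolding hybrid_G_def
  proof (rule sum.cong)
    fix T assume T: "T \<in> SVRPP_upto n lam"
    have x: "mono_pow pvar (ircont lam T) = (Poly_Mapping.single (exponent n (ircont lam T)) 1 :: (nat, 'a) mpol)"
      by (rule mono_pow_pvar) (rule ircont_nonzero[OF T])
    show "mono_pow pvar (ircont lam T) * mono_pow t (ceq lam T) * mono_pow w (ex lam T) =
        Poly_Mapping.single (exponent n (ircont lam T)) (c T)"
      unfolding x mult.assoc c[OF T] by (simp add: mult_single)
  qed simp
  then show ?thesis
    by (simp add: lookup_sum lookup_single when_def sum.If_cases finite_SVRPP_upto Int_def)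
qed

text \<open>\<open>nonzero\<close> rules out cancellation, so the support is exactly the set of
  attained weights. The free \<open>c\<close> serves both the specialization to ones and generic
  parameters.\<close>

lemma SNP_hybrid_G:
  fixes t w :: "nat \<Rightarrow> (nat, 'a::comm_semiring_1) mpol"
  assumes lam: "is_partition lam"
    and c: "\<And>T. T \<in> SVRPP_upto n lam \<Longrightarrow>
      mono_pow t (ceq lam T) * mono_pow w (ex lam T) = Poly_Mapping.single 0 (c T)"
    and nonzero: "\<And>X. X \<subseteq> SVRPP_upto n lam \<Longrightarrow> X \<noteq> {} \<Longrightarrow> sum c X \<noteq> 0"
  shows "SNP (hybrid_G lam n pvar t w)"
proof (rule SNP_if_support_inequalities)
  fix \<gamma>
  let ?X = "{T \<in> SVRPP_upto n lam. exponent n (ircont lam T) = \<gamma>}"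
  have "Poly_Mapping.lookup (hybrid_G lam n pvar t w) \<gamma> \<noteq> 0 \<longleftrightarrow> ?X \<noteq> {}"
    using lookup_hybrid_G[of n lam t w c \<gamma>, OF c] nonzero[of ?X] by (cases "?X = {}") auto
  also have "\<dots> \<longleftrightarrow> (\<exists>T\<in>SVRPP_upto n lam. exponent n (ircont lam T) = \<gamma>)" by blast
  finally show "Poly_Mapping.lookup (hybrid_G lam n pvar t w) \<gamma> \<noteq> 0 \<longleftrightarrow>
    (\<forall>k. k \<notin> {1..n} \<longrightarrow> Poly_Mapping.lookup \<gamma> k = 0) \<and>
    row_length lam 0 \<le> (\<Sum>k\<in>{1..n}. Poly_Mapping.lookup \<gamma> k) \<and>
    (\<forall>A\<subseteq>{1..n}. (\<Sum>k\<in>A. Poly_Mapping.lookup \<gamma> k) \<le> nu_sum (row_length lam) (card A))"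
    unfolding SVRPP_upto_exponent_iff[OF lam] .
qed

text \<open>An infinite support of \<open>\<alpha>\<close> is harmless, as the product then defaults
  to 1, itself a monomial.\<close>

lemma mono_pow_pconst_pvar:
  "\<exists>m. mono_pow (\<lambda>i. pconst (pvar (h i))) \<alpha> =
    (Poly_Mapping.single 0 (Poly_Mapping.single m 1) :: ('v, ('u, 'a::comm_semiring_1) mpol) mpol)"
proof -
  have "(Poly_Mapping.single 0 p) ^ k = (Poly_Mapping.single 0 (p ^ k) :: ('v, ('u, 'a) mpol) mpol)"
    for p :: "('u, 'a) mpol" and k
    by (induction k) (simp_all add: mult_single)
  moreover have "(\<Prod>k\<in>S. Poly_Mapping.single 0 (q k)) = (Poly_Mapping.single 0 (\<Prod>k\<in>S. q k) :: ('v, ('u, 'a) mpol) mpol)"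
    for q :: "nat \<Rightarrow> ('u, 'a) mpol" and S
    by (induction S rule: infinite_finite_induct) (simp_all add: mult_single)
  ultimately show ?thesis
    unfolding mono_pow_def pconst_def by (auto simp: pvar_power prod_single)
qed

text \<open>The coefficient at \<open>m T\<close> counts the members of \<open>X\<close> with that
  monomial, so it is positive.\<close>

lemma sum_monomials_nonzero:
  assumes "finite X" "X \<noteq> {}"
  shows "(\<Sum>T\<in>X. Poly_Mapping.single (m T) (1::int)) \<noteq> 0"
proof
  assume z: "(\<Sum>T\<in>X. Poly_Mapping.single (m T) (1::int)) = 0"
  obtain T where T: "T \<in> X" using assms(2) by blast
  have "(0::int) < (\<Sum>T'\<in>X. Poly_Mapping.lookup (Poly_Mapping.single (m T') 1) (m T))"
    using assms(1) T by (intro sum_pos2[of _ T]) (auto simp: lookup_single when_def)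
  then show False unfolding lookup_sum[symmetric] z by simp
qed

theorem theorem1p4:
  fixes lam :: "nat list" and n :: nat
  assumes "is_partition lam" and "0 < n"
  shows "SNP (G_at_ones lam n) \<and> SNP (G_generic lam n)"
proof
  show "SNP (G_at_ones lam n)"
    unfolding G_at_ones_def
  proof (rule SNP_hybrid_G[OF assms(1), where c = "\<lambda>_. 1"])
    show "sum (\<lambda>_. 1 :: int) X \<noteq> 0" if "X \<subseteq> SVRPP_upto n lam" "X \<noteq> {}" for X
      using that finite_subset[OF _ finite_SVRPP_upto] by (metis card_0_eq of_nat_eq_0_iff sum_constant mult.right_neutral)
  qed (simp add: mono_pow_def)
next
  let ?t = "\<lambda>i. pconst (pvar (Inl i)) :: (nat, (nat + nat, int) mpol) mpol"
  let ?w = "\<lambda>i. pconst (pvar (Inr i)) :: (nat, (nat + nat, int) mpol) mpol"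
  have "\<exists>m. mono_pow ?t (ceq lam T) * mono_pow ?w (ex lam T) =
      Poly_Mapping.single 0 (Poly_Mapping.single m 1)" for T
  proof -
    obtain a b where "mono_pow ?t (ceq lam T) = Poly_Mapping.single 0 (Poly_Mapping.single a 1)"
      "mono_pow ?w (ex lam T) = Poly_Mapping.single 0 (Poly_Mapping.single b 1)"
      using mono_pow_pconst_pvar by blast
    then have "mono_pow ?t (ceq lam T) * mono_pow ?w (ex lam T) =
        Poly_Mapping.single 0 (Poly_Mapping.single (a + b) 1)"
      by (simp add: mult_single)
    then show ?thesis ..
  qed
  then obtain m where m: "\<And>T. mono_pow ?t (ceq lam T) * mono_pow ?w (ex lam T) =
      Poly_Mapping.single 0 (Poly_Mapping.single (m T) 1)" by metis
  show "SNP (G_generic lam n)"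
    unfolding G_generic_def
    by (rule SNP_hybrid_G[OF assms(1) m])
      (use sum_monomials_nonzero finite_subset[OF _ finite_SVRPP_upto] in blast)
qed

end
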